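(* Let $A_1,\dots,A_m\in\mathbb{S}^n$ satisfy $\operatorname{tr}A_i=0$ and $\operatorname{tr}(A_iA_j)=\delta_{ij}$ for all $i,j=1,\dots,m$. Let $\mathbf{b}\in\operatorname{int}\mathscr{M}$ and $\delta:=\operatorname{dist}(\mathbf{b},\partial\mathscr{M})>0$. Then the function $f(\mathbf{y})=\log\operatorname{tr}\exp A(\mathbf{y})-\mathbf{b}^T\mathbf{y}$ is $\alpha$-strongly convex on the sublevel set $\{\mathbf{y}\in\mathbb{R}^m: f(\mathbf{y})\le\log n\}$, with $$\alpha=\frac1n\,e^{-\sqrt2\,\log n/\delta}=n^{-(1+\sqrt2/\delta)}.$$
   Context: $\mathbb{S}^n$ is the space of real symmetric $n\times n$ matrices, and $\mathbb{S}^n_1=\{X\in\mathbb{S}^n: X\succeq 0,\ \operatorname{tr}X=1\}$. $\delta_{ij}$ equals $1$ if $i=j$ and $0$ otherwise. $A(\mathbf{y})=\sum_{i=1}^m y_iA_i$, $\mathcal{A}(X)=(\operatorname{tr}(A_iX))_{i=1,\dots,m}$, and the moment body is $\mathscr{M}=\mathcal{A}(\mathbb{S}^n_1)\subset\mathbb{R}^m$, with boundary $\partial\mathscr{M}$ and interior $\operatorname{int}\mathscr{M}$ in $\mathbb{R}^m$; distances are Euclidean. For $\mathbf{b}\in\operatorname{int}\mathscr{M}$, $\delta$ is the radius of the largest Euclidean ball centered at $\mathbf{b}$ contained in $\mathscr{M}$, equivalently $\delta=\min_{\|\mathbf{v}\|_2=1}(\lambda_{\max}(A(\mathbf{v}))-\mathbf{b}^T\mathbf{v})$.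 The smooth function $f$ is called $\alpha$-strongly convex on a convex set $\mathscr{S}$ if $\nabla^2 f(\mathbf{y})\succeq\alpha I_m$ for all $\mathbf{y}\in\mathscr{S}$. *)

theory Defs
  imports "HOL-Analysis.Analysis"
begin

definition symmetric_matrix :: "real^'n^'n \<Rightarrow> bool" where
  "symmetric_matrix X \<longleftrightarrow> transpose X = X"

definition psd :: "real^'n^'n \<Rightarrow> bool" where
  "psd X \<longleftrightarrow> symmetric_matrix X \<and> (\<forall>v. 0 \<le> v \<bullet> (X *v v))"

text \<open>On the type \<^typ>\<open>real^'n^'n\<close>, \<open>*\<close> is the componentwise product, so the
  exponential series is written out with the matrix product \<open>**\<close>.\<close>

definition matrix_exp :: "real^'n^'n \<Rightarrow> real^'n^'n" where
  "matrix_exp X = (\<Sum>k. (1 / fact k) *\<^sub>R (((**) X ^^ k) (mat 1)))"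

definition spectraplex :: "(real^'n^'n) set" where
  "spectraplex = {X. psd X \<and> trace X = 1}"

definition pencil :: "('m::finite \<Rightarrow> real^'n^'n) \<Rightarrow> real^'m \<Rightarrow> real^'n^'n" where
  "pencil A y = (\<Sum>i\<in>UNIV. (y $ i) *\<^sub>R A i)"

definition trace_map :: "('m::finite \<Rightarrow> real^'n^'n) \<Rightarrow> real^'n^'n \<Rightarrow> real^'m" where
  "trace_map A X = (\<chi> i. trace (A i ** X))"

definition moment_body :: "('m::finite \<Rightarrow> real^'n^'n) \<Rightarrow> (real^'m) set" where
  "moment_body A = trace_map A ` spectraplex"

definition log_tr_exp ::
    "('m::finite \<Rightarrow> real^'n^'n) \<Rightarrow> real^'m \<Rightarrow> real^'m \<Rightarrow> real" where
  "log_tr_exp A b y = ln (trace (matrix_exp (pencil A y))) - b \<bullet> y"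

text \<open>\<open>C_k k f\<close>: \<open>f\<close> is of class \<open>C\<^sup>k\<close> on the whole space, i.e. all iterated directional
  derivatives up to order \<open>k\<close> exist and are continuous.\<close>

primrec C_k :: "nat \<Rightarrow> ('a::euclidean_space \<Rightarrow> real) \<Rightarrow> bool" where
  "C_k 0 f \<longleftrightarrow> continuous_on UNIV f"
| "C_k (Suc k) f \<longleftrightarrow>
     (\<forall>x. f differentiable (at x)) \<and> (\<forall>v. C_k k (\<lambda>x. frechet_derivative f (at x) v))"

definition smooth :: "('a::euclidean_space \<Rightarrow> real) \<Rightarrow> bool" where
  "smooth f \<longleftrightarrow> (\<forall>k. C_k k f)"

definition hessian :: "(real^'m \<Rightarrow> real) \<Rightarrow> real^'m \<Rightarrow> real^'m^'m" where
  "hessian f y =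
     (\<chi> i j. frechet_derivative (\<lambda>x. frechet_derivative f (at x) (axis j 1)) (at y) (axis i 1))"

text \<open>\<^const>\<open>frechet_derivative\<close> is total, so \<^const>\<open>hessian\<close> is meaningful only for twice
  differentiable functions; hence smoothness is part of the definition, as is convexity of
  the set.\<close>

definition strongly_convex_on :: "real \<Rightarrow> (real^'m) set \<Rightarrow> (real^'m \<Rightarrow> real) \<Rightarrow> bool" where
  "strongly_convex_on \<alpha> S f \<longleftrightarrow>
     smooth f \<and> convex S \<and> (\<forall>y\<in>S. psd (hessian f y - \<alpha> *\<^sub>R mat 1))"

end

theory Submission
  imports Defs
begin

text \<open>
  Let \<open>X = pencil A y\<close> and let \<open>\<rho> = exp X / tr (exp X)\<close> be its Gibbs state. The second derivative of the
  potential at \<open>y\<close> in the direction \<open>v\<close> is the Kubo-Mori variance of the observable \<open>V = pencil A v\<close>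
  in the state \<open>\<rho>\<close>. Written in an eigenbasis of \<open>X\<close>, this variance weights the squared entries of \<open>V\<close> by
  logarithmic means of eigenvalues of \<open>\<rho>\<close>, which are at least the smallest eigenvalue of \<open>\<rho>\<close>; because \<open>V\<close>
  is traceless, the Cauchy-Schwarz inequality shows that subtracting the squared mean does not
  destroy this bound (\<open>kubo_mori_covariance_ge_min_eigenvalue\<close>). As \<open>V\<close> has Frobenius norm \<open>|v|\<close> by
  orthonormality of the \<open>A i\<close>, the Hessian is at least the smallest eigenvalue of \<open>\<rho>\<close>.

  That eigenvalue is at least \<open>exp (\<lambda>\<^sub>m\<^sub>i\<^sub>n - \<lambda>\<^sub>m\<^sub>a\<^sub>x) / n\<close> for the extreme eigenvalues of \<open>X\<close>, and
  \<open>\<lambda>\<^sub>m\<^sub>a\<^sub>x - \<lambda>\<^sub>m\<^sub>i\<^sub>n\<close> is at most \<open>sqrt 2\<close> times the Frobenius norm of \<open>X\<close>, which is \<open>|y|\<close>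
  (\<open>kubo_mori_covariance_ge\<close>). So the Hessian is bounded below in terms of \<open>|y|\<close> alone, and it remains to
  bound \<open>|y|\<close> on the sublevel set. The expectation of \<open>X\<close> in any state is at most
  \<open>\<lambda>\<^sub>m\<^sub>a\<^sub>x \<le> ln (tr (exp X))\<close>; using this for the states that represent the points of the ball of radius
  \<open>\<delta>\<close> around \<open>b\<close> gives \<open>\<delta> |y| \<le> f(y)\<close> (\<open>log_tr_exp_coercive\<close>), hence \<open>|y| \<le> ln n / \<delta>\<close> where
  \<open>f(y) \<le> ln n\<close>.

  Smoothness rests on a family of power series that contains the exponential and is closed under
  directional derivatives (\<open>has_derivative_exp_derivative\<close>).
\<close>

section \<open>Spectral theorem for real symmetric matrices\<close>

text \<open>Moving from the maximiser \<open>v\<close> in the direction of the residual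
  \<open>w = f v - (v \<bullet> f v) v\<close> changes the Rayleigh quotient to first order by \<open>2 t (w \<bullet> w)\<close>, so
  maximality forces \<open>w = 0\<close>.\<close>

lemma rayleigh_maximiser_is_eigenvector:
  fixes f :: "'a::euclidean_space \<Rightarrow> 'a"
  assumes lin: "linear f" and sym: "\<And>x y. x \<bullet> f y = f x \<bullet> y"
    and S: "subspace S" and inv: "\<And>x. x \<in> S \<Longrightarrow> f x \<in> S"
    and v: "v \<in> S" "norm v = 1"
    and max: "\<And>x. x \<in> S \<Longrightarrow> norm x = 1 \<Longrightarrow> x \<bullet> f x \<le> v \<bullet> f v"
  shows "f v = (v \<bullet> f v) *\<^sub>R v"
proof -
  interpret f: linear f by fact
  define \<mu> where "\<mu> = v \<bullet> f v"
  define w where "w = f v - \<mu> *\<^sub>R v"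
  define c where "c = w \<bullet> f w - \<mu> * (w \<bullet> w)"
  have wS: "w \<in> S"
    unfolding w_def using S v inv by (simp add: subspace_diff subspace_scale)
  have hom: "x \<bullet> f x \<le> \<mu> * (x \<bullet> x)" if "x \<in> S" for x
  proof (cases "x = 0")
    case False
    have "(x /\<^sub>R norm x) \<bullet> f (x /\<^sub>R norm x) \<le> \<mu>"
      unfolding \<mu>_def using False that S by (intro max) (auto simp: subspace_scale)
    then show ?thesis
      using False
      by (simp add: f.scale power2_norm_eq_inner[symmetric] field_simps power2_eq_square)
  qed (simp add: f.zero)
  have vv: "v \<bullet> v = 1" using v by (simp add: dot_square_norm)
  have poly: "2 * t * (w \<bullet> w) + t\<^sup>2 * c \<le> 0" for t :: real
  proof -
    have "v + t *\<^sub>R w \<in> S" using S v wS by (simp add: subspace_add subspace_scale)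
    from hom[OF this]
    have "\<mu> + t * (v \<bullet> f w) + t * (w \<bullet> f v) + t\<^sup>2 * (w \<bullet> f w)
        \<le> \<mu> * (1 + 2 * t * (w \<bullet> v) + t\<^sup>2 * (w \<bullet> w))"
      by (simp add: f.add f.scale inner_add_left inner_add_right vv \<mu>_def[symmetric]
          inner_commute power2_eq_square algebra_simps)
    moreover have "v \<bullet> f w = w \<bullet> f v" by (subst sym) (rule inner_commute)
    moreover have wf: "w \<bullet> f v = w \<bullet> w + \<mu> * (w \<bullet> v)"
      by (subst (2) w_def) (simp add: inner_diff_right)
    ultimately show ?thesis by (simp add: wf c_def algebra_simps)
  qed
  have "w \<bullet> w = 0"
  proof (rule ccontr)
    assume "w \<bullet> w \<noteq> 0"
    then have pos: "w \<bullet> w > 0" by simp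
    define t where "t = (w \<bullet> w) / (1 + \<bar>c\<bar>)"
    have tpos: "t > 0" using pos by (simp add: t_def)
    \<comment> \<open>this \<open>t\<close> is small enough for the linear term to dominate the quadratic one\<close>
    have "t * \<bar>c\<bar> \<le> w \<bullet> w"
      using pos by (simp add: t_def field_simps)
    then have "t * c \<ge> - (w \<bullet> w)"
      using tpos by (smt (verit) mult_minus_right mult_left_mono abs_ge_minus_self)
    then have "2 * (w \<bullet> w) + t * c > 0"
      using pos by linarith
    then have "t * (2 * (w \<bullet> w) + t * c) > 0"
      using tpos by simp
    with poly[of t] show False by (simp add: algebra_simps power2_eq_square)
  qed
  then show ?thesis by (simp add: w_def \<mu>_def)
qed

text \<open>Induction on the dimension: split off a maximiser of the Rayleigh quotient and continue in its
  orthogonal complement, which is invariant again because \<open>f\<close> is self-adjoint.\<close>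

lemma orthonormal_eigenbasis_of_invariant_subspace:
  fixes f :: "'a::euclidean_space \<Rightarrow> 'a"
  assumes lin: "linear f" and sym: "\<And>x y. x \<bullet> f y = f x \<bullet> y"
    and "subspace S" and "\<And>x. x \<in> S \<Longrightarrow> f x \<in> S"
  shows "\<exists>B\<subseteq>S. pairwise orthogonal B \<and> (\<forall>v\<in>B. norm v = 1 \<and> (\<exists>\<mu>. f v = \<mu> *\<^sub>R v)) \<and> span B = S"
  using assms(3,4)
proof (induction "dim S" arbitrary: S rule: less_induct)
  case less
  show ?case
  proof (cases "S = {0}")
    case True
    then show ?thesis by (intro exI[of _ "{}"]) auto
  next
    case False
    let ?U = "S \<inter> sphere 0 1"
    obtain x where x: "x \<in> S" "x \<noteq> 0"
      using False less.prems(1) subspace_0 by blast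
    then have "x /\<^sub>R norm x \<in> ?U"
      using less.prems(1) by (simp add: subspace_scale)
    moreover have "compact ?U"
      using less.prems(1) by (simp add: closed_Int_compact closed_subspace)
    moreover have "continuous_on ?U (\<lambda>x. x \<bullet> f x)"
      using lin by (intro continuous_intros linear_continuous_on) (simp add: linear_linear)
    ultimately obtain v where v: "v \<in> ?U" and max: "\<And>x. x \<in> ?U \<Longrightarrow> x \<bullet> f x \<le> v \<bullet> f v"
      using continuous_attains_sup[of ?U "\<lambda>x. x \<bullet> f x"] by blast
    have vS: "v \<in> S" and v1: "norm v = 1" using v by auto
    have eig: "f v = (v \<bullet> f v) *\<^sub>R v"
      using max by (intro rayleigh_maximiser_is_eigenvector[OF lin sym less.prems vS v1]) auto
    let ?T = "{x \<in> S. v \<bullet> x = 0}"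
    have T: "subspace ?T"
      using less.prems(1) unfolding subspace_def by (auto simp: inner_add_right)
    have invT: "f x \<in> ?T" if "x \<in> ?T" for x
      using that less.prems(2) sym[of v x] eig by (metis (mono_tags, lifting) inner_scaleR_left
          mem_Collect_eq mult_zero_right)
    have "v \<bullet> v = 1" using v1 by (simp add: dot_square_norm)
    then have "v \<notin> ?T" by simp
    then have "?T \<subset> S" using vS by blast
    then have "dim ?T < dim S"
      using T less.prems(1) by (intro dim_psubset) (simp add: span_eq_iff[THEN iffD2])
    from less.hyps[OF this T invT] obtain B where B: "B \<subseteq> ?T" "pairwise orthogonal B"
      "\<forall>v\<in>B. norm v = 1 \<and> (\<exists>\<mu>. f v = \<mu> *\<^sub>R v)" "span B = ?T" by blast
    have "x \<in> span (insert v B)" if "x \<in> S" for x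
    proof -
      have "x - (v \<bullet> x) *\<^sub>R v \<in> ?T"
        using that vS less.prems(1) \<open>v \<bullet> v = 1\<close>
        by (simp add: subspace_diff subspace_scale inner_diff_right)
      then show ?thesis using B(4) span_breakdown_eq[of x v B] by auto
    qed
    moreover have "span (insert v B) \<subseteq> S"
      using B(1) vS less.prems(1) by (intro span_minimal) auto
    ultimately have "span (insert v B) = S" by blast
    moreover have "pairwise orthogonal (insert v B)"
      using B(1,2) by (auto simp: pairwise_insert orthogonal_def inner_commute)
    ultimately show ?thesis
      using B vS v1 eig by (intro exI[of _ "insert v B"]) auto
  qed
qed

definition diag_matrix :: "('n \<Rightarrow> real) \<Rightarrow> real^'n^'n" where
  "diag_matrix d = (\<chi> i j. if i = j then d i else 0)"

definition conjugate :: "real^'n^'n \<Rightarrow> real^'n^'n \<Rightarrow> real^'n^'n" where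
  "conjugate P X = P ** X ** transpose P"

lemma inner_symmetric_matrix:
  fixes M :: "real^'n^'n"
  assumes "symmetric_matrix M"
  shows "x \<bullet> (M *v y) = (M *v x) \<bullet> y"
  using assms dot_lmul_matrix[of x M y]
  by (metis symmetric_matrix_def transpose_matrix_vector)

text \<open>The rows of \<open>P\<close> are the vectors of an orthonormal eigenbasis of \<open>M\<close>.\<close>

lemma symmetric_matrix_diagonalizable:
  fixes M :: "real^'n^'n"
  assumes "symmetric_matrix M"
  obtains P d where "orthogonal_matrix P" "conjugate P M = diag_matrix d"
proof -
  obtain B :: "(real^'n) set" where orth: "pairwise orthogonal B"
    and nrm: "\<And>v. v \<in> B \<Longrightarrow> norm v = 1"
    and eig: "\<And>v. v \<in> B \<Longrightarrow> \<exists>\<mu>. M *v v = \<mu> *\<^sub>R v" and span: "span B = UNIV"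
    using orthonormal_eigenbasis_of_invariant_subspace[of "(*v) M" UNIV]
      inner_symmetric_matrix[OF assms] by auto
  have ind: "independent B"
    using orth nrm by (intro pairwise_orthogonal_independent) (auto, force)
  have "finite B" "card B = CARD('n)"
    using ind independent_imp_finite dim_eq_card_independent[OF ind] dim_span[of B]
    by (auto simp: span)
  then obtain u where u: "bij_betw u (UNIV :: 'n set) B"
    by (metis finite_same_card_bij finite_class.finite_UNIV)
  have uB: "u i \<in> B" for i using u by (auto simp: bij_betw_def)
  have uu: "u i \<bullet> u j = (if i = j then 1 else 0)" for i j
    using nrm[OF uB, of i] pairwiseD[OF orth uB uB, of i j] u
    by (auto simp: dot_square_norm orthogonal_def bij_betw_def inj_eq)
  obtain d where d: "M *v u i = d i *\<^sub>R u i" for i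
    using eig[OF uB] by metis
  define P :: "real^'n^'n" where "P = (\<chi> i. u i)"
  have "orthogonal_matrix P"
    unfolding orthogonal_matrix_orthonormal_rows orthogonal_def row_def
    by (auto simp: P_def uu norm_eq_sqrt_inner)
  moreover have "conjugate P M = diag_matrix d"
  proof -
    have "conjugate P M $ i $ j = u i \<bullet> (M *v u j)" for i j
      by (subst conjugate_def, subst matrix_mul_assoc[symmetric])
        (simp add: matrix_matrix_mult_def matrix_vector_mult_def inner_vec_def transpose_def P_def)
    then show ?thesis by (simp add: vec_eq_iff d uu diag_matrix_def)
  qed
  ultimately show thesis using that by blast
qed

section \<open>Matrix multiplication, trace and conjugation\<close>

lemma matrix_add_mult_distrib:
  fixes A B :: "real^'n^'m" and C :: "real^'p^'n"
  shows "(A + B) ** C = A ** C + B ** C"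
  by (simp add: matrix_matrix_mult_def vec_eq_iff sum.distrib distrib_right)

lemma matrix_mult_scaleR_right:
  fixes A :: "real^'n^'m" and B :: "real^'p^'n"
  shows "A ** (c *\<^sub>R B) = c *\<^sub>R (A ** B)"
  by (simp add: matrix_scalar_ac scalar_matrix_assoc)

lemma matrix_mult_scaleR_left:
  fixes A :: "real^'n^'m" and B :: "real^'p^'n"
  shows "(c *\<^sub>R A) ** B = c *\<^sub>R (A ** B)"
  by (simp add: scalar_matrix_assoc)

lemma bounded_bilinear_matrix_mult:
  "bounded_bilinear ((**) :: real^'n^'m \<Rightarrow> real^'p^'n \<Rightarrow> real^'p^'m)"
  unfolding bilinear_conv_bounded_bilinear[symmetric] bilinear_def
  by (auto intro!: linearI simp: matrix_add_ldistrib matrix_add_mult_distrib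
      matrix_mult_scaleR_right matrix_mult_scaleR_left)

lemma linear_trace: "linear (trace :: real^'n^'n \<Rightarrow> real)"
  by (auto intro!: linearI simp: trace_def sum.distrib sum_distrib_left)

lemma bounded_linear_trace: "bounded_linear (trace :: real^'n^'n \<Rightarrow> real)"
  using linear_trace linear_linear by blast

lemma linear_conjugate: "linear (conjugate P)"
  by (auto intro!: linearI simp: conjugate_def matrix_add_ldistrib matrix_add_mult_distrib
      matrix_mult_scaleR_right matrix_mult_scaleR_left)

context
  fixes P :: "real^'n^'n"
  assumes P: "orthogonal_matrix P"
begin

lemma conjugate_mult: "conjugate P (X ** Y) = conjugate P X ** conjugate P Y"
proof -
  have "conjugate P X ** conjugate P Y = P ** X ** (transpose P ** P) ** Y ** transpose P"
    by (simp add: conjugate_def matrix_mul_assoc)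
  also have "transpose P ** P = mat 1"
    using P by (simp add: orthogonal_matrix_def)
  finally show ?thesis
    by (simp add: conjugate_def matrix_mul_assoc)
qed

lemma conjugate_one: "conjugate P (mat 1) = mat 1"
  using P by (simp add: conjugate_def orthogonal_matrix_def)

lemma trace_conjugate: "trace (conjugate P X) = trace X"
proof -
  have "trace (conjugate P X) = trace (transpose P ** (P ** X))"
    unfolding conjugate_def by (rule trace_mul_sym)
  then show ?thesis
    using P by (simp add: orthogonal_matrix_def matrix_mul_assoc)
qed

end

lemma symmetric_conjugate:
  assumes "symmetric_matrix X"
  shows "symmetric_matrix (conjugate P X)"
  using assms by (simp add: symmetric_matrix_def conjugate_def matrix_transpose_mul matrix_mul_assoc)

section \<open>Iterated derivatives of the matrix exponential\<close>

text \<open>\<open>power_derivative k Vs X\<close> is the iterated derivative of \<open>X \<mapsto> X\<^sup>k\<close> at \<open>X\<close> in the directions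
  \<open>Vs\<close>: the sum of all words with \<open>k\<close> letters in which each entry of \<open>Vs\<close> occurs once and all
  other letters are \<open>X\<close>. The recursion splits such a word at its first letter. Allowing arbitrary
  lists of directions makes the family closed under differentiation, so that one
  differentiation theorem yields smoothness of every order.\<close>

primrec power_derivative :: "nat \<Rightarrow> (real^'n^'n) list \<Rightarrow> real^'n^'n \<Rightarrow> real^'n^'n" where
  "power_derivative 0 Vs X = (if Vs = [] then mat 1 else 0)"
| "power_derivative (Suc k) Vs X = X ** power_derivative k Vs X
     + (\<Sum>j<length Vs. Vs ! j ** power_derivative k (take j Vs @ drop (Suc j) Vs) X)"

definition exp_derivative :: "(real^'n^'n) list \<Rightarrow> real^'n^'n \<Rightarrow> real^'n^'n" where
  "exp_derivative Vs X = (\<Sum>k. (1 / fact k) *\<^sub>R power_derivative k Vs X)"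

lemma power_derivative_Nil: "power_derivative k [] X = ((**) X ^^ k) (mat 1)"
  by (induction k) auto

lemma matrix_exp_eq: "matrix_exp X = exp_derivative [] X"
  by (simp add: matrix_exp_def exp_derivative_def power_derivative_Nil)

lemma power_derivative_Suc_Cons:
  "power_derivative (Suc k) (U # Vs) X = X ** power_derivative k (U # Vs) X
     + U ** power_derivative k Vs X
     + (\<Sum>j<length Vs. Vs ! j ** power_derivative k (U # take j Vs @ drop (Suc j) Vs) X)"
  by (simp add: sum.lessThan_Suc_shift del: sum.lessThan_Suc)

text \<open>Differentiating a word in the direction \<open>U\<close> replaces one letter \<open>X\<close> by \<open>U\<close>; in the recursion
  this is the product rule applied to the first letter.\<close>

lemma has_derivative_power_derivative:
  "(power_derivative k Vs has_derivative (\<lambda>U. power_derivative k (U # Vs) X)) (at X)"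
proof (induction k arbitrary: Vs)
  case 0
  then show ?case by simp
next
  case (Suc k)
  note bb = bounded_bilinear_matrix_mult
  have *: "((\<lambda>X. Vs ! j ** power_derivative k (take j Vs @ drop (Suc j) Vs) X) has_derivative
      (\<lambda>U. Vs ! j ** power_derivative k (U # take j Vs @ drop (Suc j) Vs) X)) (at X)" for j
    by (rule bounded_linear.has_derivative[OF bounded_bilinear.bounded_linear_right[OF bb] Suc.IH])
  have "((\<lambda>X. power_derivative (Suc k) Vs X) has_derivative
      (\<lambda>U. (X ** power_derivative k (U # Vs) X + U ** power_derivative k Vs X)
        + (\<Sum>j<length Vs. Vs ! j ** power_derivative k (U # take j Vs @ drop (Suc j) Vs) X))) (at X)"
    unfolding power_derivative.simps
    by (intro has_derivative_add has_derivative_sum *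
        bounded_bilinear.FDERIV[OF bb has_derivative_ident Suc.IH])
  then show ?case
    by (simp add: power_derivative_Suc_Cons del: power_derivative.simps)
qed

lemma linear_power_derivative_Cons: "linear (\<lambda>U. power_derivative k (U # Vs) X)"
  using has_derivative_power_derivative has_derivative_linear by blast

text \<open>With \<open>r\<close> directions there are at most \<open>(r + 1)\<^sup>k\<close> words with \<open>k\<close> letters. The constant \<open>K\<close> accounts
  for the submultiplicativity of the norm up to a factor.\<close>

lemma norm_power_derivative_le:
  obtains K where "K > 0"
    and "\<And>k Vs R (X :: real^'n^'n). norm X \<le> R \<Longrightarrow> (\<And>V. V \<in> set Vs \<Longrightarrow> norm V \<le> R)
      \<Longrightarrow> norm (power_derivative k Vs X)
        \<le> norm (mat 1 :: real^'n^'n) * (real (Suc (length Vs)) * (R * K)) ^ k"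
proof -
  obtain K where K: "K > 0" "\<And>(A :: real^'n^'n) (B :: real^'n^'n). norm (A ** B) \<le> norm A * norm B * K"
    using bounded_bilinear.pos_bounded[OF bounded_bilinear_matrix_mult] by blast
  define N where "N = norm (mat 1 :: real^'n^'n)"
  have N0: "N \<ge> 0" by (simp add: N_def)
  have "norm (power_derivative k Vs X) \<le> N * (real (Suc (length Vs)) * (R * K)) ^ k"
    if X: "norm X \<le> R" and Vs: "\<And>V. V \<in> set Vs \<Longrightarrow> norm V \<le> R" for k Vs R and X :: "real^'n^'n"
    using Vs
  proof (induction k arbitrary: Vs)
    case 0
    then show ?case by (simp add: N_def)
  next
    case (Suc k)
    have R: "0 \<le> R" using norm_ge_zero X by (rule order_trans)
    define b where "b = N * (real (Suc (length Vs)) * (R * K)) ^ k"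
    have prod: "norm (V ** W) \<le> R * b * K" if "norm V \<le> R" "norm W \<le> b" for V W :: "real^'n^'n"
    proof -
      have "norm V * norm W \<le> R * b" using that R by (intro mult_mono) auto
      then show ?thesis
        using K(1) by (intro order_trans[OF K(2)[of V W]] mult_right_mono) auto
    qed
    have "norm (X ** power_derivative k Vs X) \<le> R * b * K"
      using X Suc by (intro prod) (auto simp: b_def)
    moreover have "norm (Vs ! j ** power_derivative k (take j Vs @ drop (Suc j) Vs) X) \<le> R * b * K"
      if "j < length Vs" for j
    proof (rule prod)
      show "norm (Vs ! j) \<le> R" using that Suc.prems by simp
      have "norm (power_derivative k (take j Vs @ drop (Suc j) Vs) X)
          \<le> N * (real (Suc (length (take j Vs @ drop (Suc j) Vs))) * (R * K)) ^ k"
        using Suc.prems by (intro Suc.IH) (auto dest: in_set_takeD in_set_dropD)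
      also have "\<dots> \<le> b"
        unfolding b_def using R K(1) N0 that by (intro mult_left_mono power_mono mult_right_mono) auto
      finally show "norm (power_derivative k (take j Vs @ drop (Suc j) Vs) X) \<le> b" .
    qed
    then have "norm (\<Sum>j<length Vs. Vs ! j ** power_derivative k (take j Vs @ drop (Suc j) Vs) X)
        \<le> (\<Sum>j<length Vs. R * b * K)"
      by (intro sum_norm_le) auto
    ultimately have "norm (power_derivative (Suc k) Vs X) \<le> R * b * K + real (length Vs) * (R * b * K)"
      by (simp add: norm_triangle_mono)
    then show ?case by (simp add: b_def algebra_simps)
  qed
  with K(1) show thesis by (intro that) (auto simp: N_def)
qed

text \<open>One summable majorant, uniform on a ball, serves both for the series and for its termwise
  derivative. The second bound follows from the case \<open>norm U \<le> 1\<close> by homogeneity.\<close>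

lemma exp_derivative_majorant:
  fixes Vs :: "(real^'n^'n) list"
  obtains M where "summable M"
    and "\<And>k X. norm X \<le> R \<Longrightarrow> norm ((1 / fact k) *\<^sub>R power_derivative k Vs X) \<le> M k"
    and "\<And>k X U. norm X \<le> R \<Longrightarrow>
      norm ((1 / fact k) *\<^sub>R power_derivative k (U # Vs) X) \<le> M k * norm U"
proof -
  obtain K where K: "K > 0" "\<And>k Vs R (X :: real^'n^'n).
      norm X \<le> R \<Longrightarrow> (\<And>V. V \<in> set Vs \<Longrightarrow> norm V \<le> R) \<Longrightarrow>
      norm (power_derivative k Vs X) \<le> norm (mat 1 :: real^'n^'n) * (real (Suc (length Vs)) * (R * K)) ^ k"
    using norm_power_derivative_le by blast
  define N where "N = norm (mat 1 :: real^'n^'n)"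
  define R' where "R' = \<bar>R\<bar> + 1 + (\<Sum>V\<leftarrow>Vs. norm V)"
  define c where "c = real (Suc (Suc (length Vs))) * (R' * K)"
  define M where "M = (\<lambda>k. N * (c ^ k / fact k))"
  have sum0: "0 \<le> (\<Sum>V\<leftarrow>Vs. norm V)" by (rule sum_list_nonneg) auto
  have VsR: "norm V \<le> R'" if "V \<in> set Vs" for V
  proof -
    have "norm V \<le> (\<Sum>V\<leftarrow>Vs. norm V)"
      using that by (intro member_le_sum_list) auto
    then show ?thesis by (simp add: R'_def)
  qed
  have RR': "R \<le> R'" "1 \<le> R'" using sum0 by (auto simp: R'_def)
  have "summable M"
    unfolding M_def using summable_exp[of c] by (intro summable_mult) (simp add: divide_inverse mult.commute)
  moreover have "norm ((1 / fact k) *\<^sub>R power_derivative k Vs X) \<le> M k" if "norm X \<le> R" for k X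
  proof -
    have "norm (power_derivative k Vs X) \<le> N * (real (Suc (length Vs)) * (R' * K)) ^ k"
      using K(2)[of X R' Vs k] that VsR RR' by (auto simp: N_def)
    also have "\<dots> \<le> N * c ^ k"
      unfolding c_def N_def using K(1) RR' by (intro mult_left_mono power_mono mult_right_mono) auto
    finally show ?thesis by (simp add: M_def field_simps)
  qed
  moreover have "norm ((1 / fact k) *\<^sub>R power_derivative k (U # Vs) X) \<le> M k * norm U"
    if "norm X \<le> R" for k X U
  proof -
    interpret lin: linear "\<lambda>U. power_derivative k (U # Vs) X" by (rule linear_power_derivative_Cons)
    have unit: "norm (power_derivative k (sgn U # Vs) X) \<le> N * c ^ k"
    proof -
      have "norm V \<le> R'" if "V \<in> set (sgn U # Vs)" for V
        using that VsR RR'(2) by (auto simp: norm_sgn)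
      from K(2)[where k = k and Vs = "sgn U # Vs", OF order_trans[OF \<open>norm X \<le> R\<close> RR'(1)] this]
      show ?thesis by (simp add: N_def c_def)
    qed
    have "U = norm U *\<^sub>R sgn U" by (cases "U = 0") (simp_all add: sgn_div_norm)
    then have "power_derivative k (U # Vs) X = norm U *\<^sub>R power_derivative k (sgn U # Vs) X"
      using lin.scale[of "norm U" "sgn U"] by simp
    then show ?thesis
      using mult_left_mono[OF unit norm_ge_zero[of U]] by (simp add: M_def field_simps)
  qed
  ultimately show thesis using that by blast
qed

lemma exp_derivative_sums:
  "(\<lambda>k. (1 / fact k) *\<^sub>R power_derivative k Vs X) sums exp_derivative Vs X"
proof -
  obtain M where "summable M" "\<And>k. norm ((1 / fact k) *\<^sub>R power_derivative k Vs X) \<le> M k"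
    using exp_derivative_majorant[of "norm X" Vs] by (metis order_refl)
  then have "summable (\<lambda>k. (1 / fact k) *\<^sub>R power_derivative k Vs X)"
    by (rule summable_comparison_test'[where N = 0])
  then show ?thesis by (simp add: exp_derivative_def summable_sums)
qed

text \<open>Termwise differentiation, justified by the locally uniform majorant.\<close>

lemma has_derivative_exp_derivative:
  fixes X :: "real^'n^'n"
  shows "(exp_derivative Vs has_derivative (\<lambda>U. exp_derivative (U # Vs) X)) (at X)"
proof -
  let ?f = "\<lambda>k X. (1 / fact k) *\<^sub>R power_derivative k Vs X"
  let ?f' = "\<lambda>k X U. (1 / fact k) *\<^sub>R power_derivative k (U # Vs) X"
  define S where "S = ball (0 :: real^'n^'n) (norm X + 1)"
  obtain M where M: "summable M"
    "\<And>k X' U. norm X' \<le> norm X + 1 \<Longrightarrow> norm (?f' k X' U) \<le> M k * norm U"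
    using exp_derivative_majorant[of "norm X + 1" Vs] by metis
  have XS: "X \<in> S" by (simp add: S_def)
  have "\<exists>g. \<forall>x\<in>S. (\<lambda>n. ?f n x) sums g x \<and>
      (g has_derivative (\<lambda>U. exp_derivative (U # Vs) x)) (at x within S)"
  proof (rule has_derivative_series)
    show "convex S" by (simp add: S_def)
    show "(?f n has_derivative ?f' n x) (at x within S)" if "x \<in> S" for n x
      by (rule has_derivative_scaleR_right[OF has_derivative_at_withinI[OF has_derivative_power_derivative]])
    show "\<forall>\<^sub>F n in sequentially. \<forall>x\<in>S. \<forall>h.
        norm ((\<Sum>i<n. ?f' i x h) - exp_derivative (h # Vs) x) \<le> e * norm h" if "e > 0" for e
    proof -
      have "\<forall>\<^sub>F n in sequentially. norm (\<Sum>i. M (i + n)) < e"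
        using suminf_exist_split[OF that M(1)] by (auto simp: eventually_sequentially)
      then show ?thesis
      proof eventually_elim
        case (elim n)
        show ?case
        proof (intro ballI allI)
          fix x h :: "real^'n^'n" assume "x \<in> S"
          then have x: "norm x \<le> norm X + 1" by (simp add: S_def)
          have sm: "summable (\<lambda>i. M (i + n) * norm h)"
            using M(1) by (intro summable_mult2) (simp add: summable_iff_shift)
          have "(\<Sum>i<n. ?f' i x h) - exp_derivative (h # Vs) x = - (\<Sum>i. ?f' (i + n) x h)"
            using suminf_split_initial_segment[OF sums_summable[OF exp_derivative_sums], of "h # Vs" x n]
            by (simp add: sums_unique[OF exp_derivative_sums, symmetric])
          also have "norm \<dots> \<le> (\<Sum>i. M (i + n) * norm h)"
            unfolding norm_minus_cancel
            using M(2)[OF x] sm by (intro norm_suminf_le) auto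
          also have "\<dots> = (\<Sum>i. M (i + n)) * norm h"
            using M(1) by (intro suminf_mult2[symmetric]) (simp add: summable_iff_shift)
          also have "\<dots> \<le> e * norm h"
            using elim by (intro mult_right_mono) auto
          finally show "norm ((\<Sum>i<n. ?f' i x h) - exp_derivative (h # Vs) x) \<le> e * norm h" .
        qed
      qed
    qed
    show "X \<in> S" by fact
    show "(\<lambda>n. ?f n X) sums exp_derivative Vs X" by (rule exp_derivative_sums)
  qed
  then obtain g where g: "\<And>x. x \<in> S \<Longrightarrow> (\<lambda>n. ?f n x) sums g x"
    and g': "(g has_derivative (\<lambda>U. exp_derivative (U # Vs) X)) (at X within S)"
    using XS by blast
  have "g x = exp_derivative Vs x" if "x \<in> S" for x
    using sums_unique2[OF g[OF that] exp_derivative_sums] .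
  then have "(exp_derivative Vs has_derivative (\<lambda>U. exp_derivative (U # Vs) X)) (at X within S)"
    by (intro has_derivative_transform[OF XS _ g']) simp
  then show ?thesis
    using at_within_open[of X S] XS by (simp add: S_def)
qed

section \<open>Calculus of functions of class \<open>C\<^sup>k\<close>\<close>

text \<open>The predicate \<open>C_k\<close> speaks about \<open>frechet_derivative\<close>. This introduction rule and the
  elimination rule below replace it by any explicit family of derivatives.\<close>

lemma C_k_Suc_has_derivativeI:
  assumes "\<And>x. (f has_derivative f' x) (at x)" and "\<And>v. C_k k (\<lambda>x. f' x v)"
  shows "C_k (Suc k) f"
proof -
  have "frechet_derivative f (at x) = f' x" for x
    using frechet_derivative_at[OF assms(1)] by simp
  then show ?thesis
    using assms by (auto simp: differentiable_def)
qed

lemma C_k_SucE: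
  assumes "C_k (Suc k) f"
  obtains f' where "\<And>x. (f has_derivative f' x) (at x)" and "\<And>v. C_k k (\<lambda>x. f' x v)"
  using assms that[of "\<lambda>x. frechet_derivative f (at x)"] by (simp add: frechet_derivative_works)

lemma C_k_imp_continuous_on: "C_k k f \<Longrightarrow> continuous_on UNIV f"
  by (cases k) (auto intro: continuous_at_imp_continuous_on differentiable_imp_continuous_within)

lemma C_k_antimono_Suc: "C_k (Suc k) f \<Longrightarrow> C_k k f"
proof (induction k arbitrary: f)
  case 0
  then show ?case by (rule C_k_imp_continuous_on[THEN C_k.simps(1)[THEN iffD2]])
next
  case (Suc k)
  obtain f' where f: "\<And>x. (f has_derivative f' x) (at x)" "\<And>v. C_k (Suc k) (\<lambda>x. f' x v)"
    using Suc.prems by (rule C_k_SucE) blast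
  show ?case by (rule C_k_Suc_has_derivativeI[OF f(1) Suc.IH[OF f(2)]])
qed

lemma C_k_const: "C_k k (\<lambda>x. c)"
proof (induction k arbitrary: c)
  case (Suc k)
  then show ?case by (intro C_k_Suc_has_derivativeI[where f' = "\<lambda>x v. 0"]) (auto intro: derivative_intros)
qed simp

lemma C_k_bounded_linear: "bounded_linear f \<Longrightarrow> C_k k f"
proof (cases k)
  case (Suc k)
  assume "bounded_linear f"
  then show ?thesis
    unfolding Suc by (intro C_k_Suc_has_derivativeI[where f' = "\<lambda>x. f"] C_k_const bounded_linear_imp_has_derivative)
qed (simp add: linear_continuous_on)

lemma C_k_add: "C_k k f \<Longrightarrow> C_k k g \<Longrightarrow> C_k k (\<lambda>x. f x + g x)"
proof (induction k arbitrary: f g)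
  case (Suc k)
  obtain f' where f: "\<And>x. (f has_derivative f' x) (at x)" "\<And>v. C_k k (\<lambda>x. f' x v)"
    using Suc.prems(1) by (rule C_k_SucE) blast
  obtain g' where g: "\<And>x. (g has_derivative g' x) (at x)" "\<And>v. C_k k (\<lambda>x. g' x v)"
    using Suc.prems(2) by (rule C_k_SucE) blast
  show ?case
    by (rule C_k_Suc_has_derivativeI[where f' = "\<lambda>x v. f' x v + g' x v"])
      (auto intro: has_derivative_add f g Suc.IH)
qed (auto intro: continuous_intros)

lemma C_k_mult: "C_k k f \<Longrightarrow> C_k k g \<Longrightarrow> C_k k (\<lambda>x. f x * g x)"
proof (induction k arbitrary: f g)
  case (Suc k)
  obtain f' where f: "\<And>x. (f has_derivative f' x) (at x)" "\<And>v. C_k k (\<lambda>x. f' x v)"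
    using Suc.prems(1) by (rule C_k_SucE) blast
  obtain g' where g: "\<And>x. (g has_derivative g' x) (at x)" "\<And>v. C_k k (\<lambda>x. g' x v)"
    using Suc.prems(2) by (rule C_k_SucE) blast
  show ?case
    using Suc.prems[THEN C_k_antimono_Suc] f g
    by (intro C_k_Suc_has_derivativeI[where f' = "\<lambda>x v. f x * g' x v + f' x v * g x"]
        has_derivative_mult C_k_add Suc.IH)
qed (auto intro: continuous_intros)

lemma C_k_inverse: "C_k k f \<Longrightarrow> (\<And>x. f x \<noteq> 0) \<Longrightarrow> C_k k (\<lambda>x. inverse (f x))"
proof (induction k arbitrary: f)
  case (Suc k)
  obtain f' where f: "\<And>x. (f has_derivative f' x) (at x)" "\<And>v. C_k k (\<lambda>x. f' x v)"
    using Suc.prems(1) by (rule C_k_SucE) blast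
  have inv: "C_k k (\<lambda>x. inverse (f x))"
    by (rule Suc.IH[OF C_k_antimono_Suc[OF Suc.prems(1)] Suc.prems(2)])
  show ?case
  proof (rule C_k_Suc_has_derivativeI)
    show "((\<lambda>x. inverse (f x)) has_derivative
        (\<lambda>v. - 1 * (inverse (f x) * f' x v * inverse (f x)))) (at x)" for x
      using Deriv.has_derivative_inverse[OF Suc.prems(2) f(1)] by simp
    show "C_k k (\<lambda>x. - 1 * (inverse (f x) * f' x v * inverse (f x)))" for v
      by (intro C_k_mult C_k_const inv f(2))
  qed
qed (auto intro: continuous_intros)

lemma C_k_ln:
  assumes C: "C_k k f" and pos: "\<And>x. f x > 0"
  shows "C_k k (\<lambda>x. ln (f x))"
proof (cases k)
  case 0
  then show ?thesis
    using C pos by (auto intro!: continuous_on_ln simp: less_imp_neq[THEN not_sym])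
next
  case (Suc k')
  obtain f' where f: "\<And>x. (f has_derivative f' x) (at x)" "\<And>v. C_k k' (\<lambda>x. f' x v)"
    using C unfolding Suc by (rule C_k_SucE) blast
  have inv: "C_k k' (\<lambda>x. inverse (f x))"
    using C_k_antimono_Suc[OF C[unfolded Suc]] pos
    by (intro C_k_inverse) (auto simp: less_imp_neq[THEN not_sym])
  show ?thesis
    unfolding Suc
  proof (rule C_k_Suc_has_derivativeI)
    show "((\<lambda>x. ln (f x)) has_derivative (\<lambda>v. f' x v * inverse (f x))) (at x)" for x
      by (rule has_derivative_ln[OF pos f(1)])
    show "C_k k' (\<lambda>x. f' x v * inverse (f x))" for v
      by (rule C_k_mult[OF f(2) inv])
  qed
qed

lemma C_k_linear_compose:
  fixes L :: "'a::euclidean_space \<Rightarrow> 'b::euclidean_space"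
  assumes "linear L"
  shows "C_k k f \<Longrightarrow> C_k k (\<lambda>x. f (L x))"
proof (induction k arbitrary: f)
  case 0
  then show ?case
    using assms linear_continuous_on[of L UNIV] continuous_on_compose2[of UNIV f UNIV L]
    by (simp add: linear_linear)
next
  case (Suc k)
  obtain f' where f: "\<And>x. (f has_derivative f' x) (at x)" "\<And>v. C_k k (\<lambda>x. f' x v)"
    using Suc.prems by (rule C_k_SucE) blast
  show ?case
  proof (rule C_k_Suc_has_derivativeI)
    show "((\<lambda>x. f (L x)) has_derivative (\<lambda>v. f' (L x) (L v))) (at x)" for x
      using linear_imp_has_derivative[OF assms] f(1) by (rule has_derivative_compose)
    show "C_k k (\<lambda>x. f' (L x) (L v))" for v
      by (rule Suc.IH) (rule f(2))
  qed
qed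

lemma has_derivative_trace_exp_derivative:
  "((\<lambda>X. trace (W ** exp_derivative Vs X)) has_derivative
    (\<lambda>U. trace (W ** exp_derivative (U # Vs) X))) (at X)"
  by (rule bounded_linear.has_derivative[OF bounded_linear_trace],
      rule bounded_linear.has_derivative[OF bounded_bilinear.bounded_linear_right[OF
            bounded_bilinear_matrix_mult]],
      rule has_derivative_exp_derivative)

text \<open>The induction passes to longer lists of directions, hence the statement for arbitrary \<open>Vs\<close>.\<close>

lemma C_k_trace_exp_derivative: "C_k k (\<lambda>X. trace (exp_derivative Vs X))"
proof (induction k arbitrary: Vs)
  case 0
  have "isCont (\<lambda>X. trace (exp_derivative Vs X)) X" for X
    using has_derivative_continuous[OF has_derivative_trace_exp_derivative[of "mat 1" Vs X]] by simp
  then show ?case by (simp add: continuous_at_imp_continuous_on)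
next
  case (Suc k)
  show ?case
    using has_derivative_trace_exp_derivative[of "mat 1" Vs]
    by (intro C_k_Suc_has_derivativeI[OF _ Suc.IH]) simp
qed

section \<open>The exponential in an eigenbasis\<close>

text \<open>Conjugation by an orthogonal matrix is an algebra homomorphism that preserves traces, so it
  reduces all computations at a symmetric matrix to computations at a diagonal one.\<close>

lemma conjugate_power_derivative:
  assumes "orthogonal_matrix P"
  shows "conjugate P (power_derivative k Vs X)
    = power_derivative k (map (conjugate P) Vs) (conjugate P X)"
proof (induction k arbitrary: Vs)
  case 0
  then show ?case
    using conjugate_one[OF assms] linear_0[OF linear_conjugate] by auto
next
  case (Suc k)
  have "map (conjugate P) (take j Vs @ drop (Suc j) Vs)
      = take j (map (conjugate P) Vs) @ drop (Suc j) (map (conjugate P) Vs)" for j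
    by (simp add: take_map drop_map)
  then show ?case
    by (simp add: linear_add[OF linear_conjugate] linear_sum[OF linear_conjugate]
        conjugate_mult[OF assms] Suc.IH)
qed

lemma conjugate_exp_derivative:
  assumes "orthogonal_matrix P"
  shows "conjugate P (exp_derivative Vs X) = exp_derivative (map (conjugate P) Vs) (conjugate P X)"
proof -
  have "(\<lambda>k. conjugate P ((1 / fact k) *\<^sub>R power_derivative k Vs X)) sums
      conjugate P (exp_derivative Vs X)"
    by (rule bounded_linear.sums[OF linear_linear[THEN iffD2, OF linear_conjugate] exp_derivative_sums])
  then have "(\<lambda>k. (1 / fact k) *\<^sub>R power_derivative k (map (conjugate P) Vs) (conjugate P X)) sums
      conjugate P (exp_derivative Vs X)"
    by (simp add: linear_cmul[OF linear_conjugate] conjugate_power_derivative[OF assms])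
  then show ?thesis
    using exp_derivative_sums sums_unique2 by blast
qed

lemma diag_matrix_mult_nth: "(diag_matrix d ** X) $ i $ j = d i * X $ i $ j"
proof -
  have "(\<Sum>k\<in>UNIV. (if i = k then d i else 0) * X $ k $ j)
      = (\<Sum>k\<in>UNIV. if i = k then d i * X $ k $ j else 0)"
    by (rule sum.cong) auto
  then show ?thesis by (simp add: matrix_matrix_mult_def diag_matrix_def)
qed

lemma mult_diag_matrix_nth: "(X ** diag_matrix d) $ i $ j = X $ i $ j * d j"
proof -
  have "(\<Sum>k\<in>UNIV. X $ i $ k * (if k = j then d k else 0))
      = (\<Sum>k\<in>UNIV. if k = j then X $ i $ k * d j else 0)"
    by (rule sum.cong) auto
  then show ?thesis by (simp add: matrix_matrix_mult_def diag_matrix_def)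
qed

text \<open>The divided difference \<open>(x\<^sup>k - y\<^sup>k) / (x - y)\<close>, extended to \<open>x = y\<close> by the derivative. The recursion
  is the one that the entries of \<open>power_derivative k [V]\<close> satisfy at a diagonal matrix.\<close>

primrec power_slope :: "nat \<Rightarrow> real \<Rightarrow> real \<Rightarrow> real" where
  "power_slope 0 x y = 0"
| "power_slope (Suc k) x y = x * power_slope k x y + y ^ k"

lemma power_slope_mult: "power_slope k x y * (x - y) = x ^ k - y ^ k"
proof (induction k)
  case (Suc k)
  have "power_slope (Suc k) x y * (x - y) = x * (power_slope k x y * (x - y)) + y ^ k * (x - y)"
    by (simp add: algebra_simps)
  also have "\<dots> = x ^ Suc k - y ^ Suc k"
    unfolding Suc.IH by (simp add: algebra_simps)
  finally show ?case .
qed simp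

lemma power_slope_same: "power_slope (Suc k) x x = real (Suc k) * x ^ k"
  by (induction k) (auto simp: algebra_simps)

text \<open>The divided difference of the exponential function, which is the logarithmic mean of \<open>exp x\<close>
  and \<open>exp y\<close>.\<close>

definition exp_slope :: "real \<Rightarrow> real \<Rightarrow> real" where
  "exp_slope x y = (if x = y then exp x else (exp x - exp y) / (x - y))"

lemma exp_slope_same [simp]: "exp_slope x x = exp x"
  by (simp add: exp_slope_def)

lemma exp_slope_commute: "exp_slope x y = exp_slope y x"
  by (auto simp: exp_slope_def field_simps)

text \<open>By convexity the slope of a chord of \<open>exp\<close> is at least the derivative at its left end.\<close>

lemma exp_le_exp_slope:
  assumes "m \<le> x" "m \<le> y"
  shows "exp m \<le> exp_slope x y"
proof -
  have "exp m \<le> exp_slope x y" if "m \<le> y" "y < x" for x y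
  proof -
    have "exp y * (1 + (x - y)) \<le> exp y * exp (x - y)"
      by (intro mult_left_mono exp_ge_add_one_self) auto
    then have "exp y * (x - y) \<le> exp x - exp y"
      by (simp add: exp_diff algebra_simps)
    then have "exp y \<le> exp_slope x y"
      using that by (simp add: exp_slope_def pos_le_divide_eq)
    then show ?thesis
      using that by (meson exp_le_cancel_iff order_trans)
  qed
  from this[of x y] this[of y x] assms show ?thesis
    by (cases x y rule: linorder_cases) (auto simp: exp_slope_commute[of y x])
qed

lemma power_slope_sums: "(\<lambda>k. power_slope k x y / fact k) sums exp_slope x y"
proof (cases "x = y")
  case True
  have "(\<lambda>k. x ^ k / fact k) sums exp x"
    using exp_converges[of x] by (simp add: divide_inverse mult.commute)
  then have "(\<lambda>k. power_slope (Suc k) x x / fact (Suc k)) sums exp x"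
    by (simp add: power_slope_same field_simps del: power_slope.simps of_nat_Suc)
  then have "(\<lambda>k. power_slope k x x / fact k) sums (exp x + power_slope 0 x x / fact 0)"
    by (subst (asm) sums_Suc_iff) simp
  then show ?thesis using True by simp
next
  case False
  have eq: "power_slope k x y / fact k = (x ^ k / fact k - y ^ k / fact k) / (x - y)" for k
  proof -
    have "power_slope k x y = (x ^ k - y ^ k) / (x - y)"
      using power_slope_mult[of k x y] False by (simp add: field_simps)
    then show ?thesis by (simp add: diff_divide_distrib mult.commute)
  qed
  have "(\<lambda>k. (x ^ k / fact k - y ^ k / fact k) / (x - y)) sums ((exp x - exp y) / (x - y))"
    using exp_converges[of x] exp_converges[of y]
    by (intro sums_divide sums_diff) (simp_all add: divide_inverse mult.commute)
  then show ?thesis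
    using False by (simp add: eq exp_slope_def)
qed

lemma power_derivative_diag: "power_derivative k [] (diag_matrix d) = diag_matrix (\<lambda>i. d i ^ k)"
proof (induction k)
  case 0
  show ?case by (simp add: diag_matrix_def mat_def)
next
  case (Suc k)
  then show ?case
    by (simp add: vec_eq_iff diag_matrix_mult_nth) (simp add: diag_matrix_def)
qed

text \<open>At a diagonal matrix the derivative of a power acts entrywise, as a Schur product with a matrix
  of divided differences (the Daleckii-Krein formula).\<close>

lemma power_derivative_diag_direction:
  "power_derivative k [V] (diag_matrix d) $ i $ j = V $ i $ j * power_slope k (d i) (d j)"
  by (induction k)
    (simp_all add: power_derivative_diag diag_matrix_mult_nth mult_diag_matrix_nth algebra_simps)

lemma exp_derivative_sums_nth:
  "(\<lambda>k. power_derivative k Vs X $ i $ j / fact k) sums (exp_derivative Vs X $ i $ j)"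
  using bounded_linear.sums[OF bounded_linear_vec_nth[of j]
      bounded_linear.sums[OF bounded_linear_vec_nth[of i] exp_derivative_sums[of Vs X]]]
  by simp

lemma exp_derivative_diag: "exp_derivative [] (diag_matrix d) = diag_matrix (\<lambda>i. exp (d i))"
proof -
  have "(\<lambda>k. (if i = j then d i ^ k else 0) / fact k) sums (if i = j then exp (d i) else 0)" for i j
    using exp_converges[of "d i"] by (auto simp: divide_inverse mult.commute)
  moreover have "(\<lambda>k. (if i = j then d i ^ k else 0) / fact k) sums
      (exp_derivative [] (diag_matrix d) $ i $ j)" for i j
    using exp_derivative_sums_nth[of "[]" "diag_matrix d" i j]
    by (simp only: power_derivative_diag) (simp add: diag_matrix_def)
  ultimately have "exp_derivative [] (diag_matrix d) $ i $ j = (if i = j then exp (d i) else 0)" for i j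
    using sums_unique2 by blast
  then show ?thesis by (simp add: vec_eq_iff diag_matrix_def)
qed

lemma exp_derivative_diag_direction:
  "exp_derivative [V] (diag_matrix d) $ i $ j = V $ i $ j * exp_slope (d i) (d j)"
proof -
  have "(\<lambda>k. V $ i $ j * (power_slope k (d i) (d j) / fact k)) sums (V $ i $ j * exp_slope (d i) (d j))"
    by (intro sums_mult power_slope_sums)
  moreover have "(\<lambda>k. V $ i $ j * (power_slope k (d i) (d j) / fact k)) sums
      (exp_derivative [V] (diag_matrix d) $ i $ j)"
    using exp_derivative_sums_nth[of "[V]" "diag_matrix d" i j]
    by (simp add: power_derivative_diag_direction)
  ultimately show ?thesis by (rule sums_unique2[symmetric])
qed

lemma trace_mult: "trace (X ** Y) = (\<Sum>i\<in>UNIV. \<Sum>j\<in>UNIV. X $ i $ j * Y $ j $ i)"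
  by (simp add: trace_def matrix_matrix_mult_def)

locale diagonalized =
  fixes P X :: "real^'n^'n" and d :: "'n \<Rightarrow> real"
  assumes P: "orthogonal_matrix P" and diag: "conjugate P X = diag_matrix d"
begin

lemma trace_mult_conjugate: "trace (U ** W) = trace (conjugate P U ** conjugate P W)"
  using trace_conjugate[OF P, of "U ** W"] by (simp add: conjugate_mult[OF P])

lemma trace_mult_diagonalized: "trace (X ** U) = (\<Sum>i\<in>UNIV. d i * conjugate P U $ i $ i)"
  by (subst trace_mult_conjugate) (simp add: diag trace_def diag_matrix_mult_nth)

lemma trace_exp: "trace (exp_derivative [] X) = (\<Sum>i\<in>UNIV. exp (d i))"
  using trace_conjugate[OF P, of "exp_derivative [] X"]
  by (simp add: conjugate_exp_derivative[OF P] diag exp_derivative_diag trace_def)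
    (simp add: diag_matrix_def)

lemma trace_mult_exp:
  "trace (U ** exp_derivative [] X) = (\<Sum>i\<in>UNIV. conjugate P U $ i $ i * exp (d i))"
  by (subst trace_mult_conjugate)
    (simp add: conjugate_exp_derivative[OF P] diag exp_derivative_diag trace_def mult_diag_matrix_nth)

text \<open>Only diagonal entries contribute to the trace, and there the divided difference is the
  derivative.\<close>

lemma trace_exp_direction: "trace (exp_derivative [U] X) = trace (U ** exp_derivative [] X)"
  using trace_conjugate[OF P, of "exp_derivative [U] X"]
  by (simp add: conjugate_exp_derivative[OF P] diag trace_def exp_derivative_diag_direction
      trace_mult_exp[unfolded trace_def])

lemma trace_mult_exp_direction:
  "trace (U ** exp_derivative [V] X)
    = (\<Sum>i\<in>UNIV. \<Sum>j\<in>UNIV. conjugate P U $ i $ j * conjugate P V $ j $ i * exp_slope (d i) (d j))"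
  by (subst trace_mult_conjugate)
    (simp add: conjugate_exp_derivative[OF P] diag trace_mult exp_derivative_diag_direction
      exp_slope_commute mult.assoc)

end

section \<open>The Kubo-Mori covariance and its lower bound\<close>

lemma trace_matrix_exp_pos:
  assumes "symmetric_matrix X"
  shows "trace (matrix_exp X) > 0"
proof -
  obtain P d where "diagonalized P X d"
    using symmetric_matrix_diagonalizable[OF assms] unfolding diagonalized_def by metis
  then show ?thesis
    by (simp add: diagonalized.trace_exp matrix_exp_eq sum_pos)
qed

text \<open>The covariance of the observables \<open>U\<close> and \<open>V\<close> in the Gibbs state \<open>exp X / tr (exp X)\<close>. It is the
  second derivative of \<open>X \<mapsto> ln (tr (exp X))\<close> in the directions \<open>U\<close> and \<open>V\<close> at symmetric \<open>X\<close>.\<close>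

definition kubo_mori_covariance ::
    "real^'n^'n \<Rightarrow> real^'n^'n \<Rightarrow> real^'n^'n \<Rightarrow> real" where
  "kubo_mori_covariance X U V =
     trace (U ** exp_derivative [V] X) / trace (matrix_exp X)
     - trace (U ** matrix_exp X) * trace (V ** matrix_exp X) / (trace (matrix_exp X))\<^sup>2"

lemma kubo_mori_covariance_commute:
  assumes "symmetric_matrix X"
  shows "kubo_mori_covariance X U V = kubo_mori_covariance X V U"
proof -
  obtain P d where D: "diagonalized P X d"
    using symmetric_matrix_diagonalizable[OF assms] unfolding diagonalized_def by metis
  have "trace (U ** exp_derivative [V] X) = trace (V ** exp_derivative [U] X)"
    unfolding diagonalized.trace_mult_exp_direction[OF D]
    by (subst sum.swap) (simp add: exp_slope_commute mult.commute)
  then show ?thesis by (simp add: kubo_mori_covariance_def mult.commute)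
qed

lemma linear_kubo_mori_covariance_left: "linear (\<lambda>U. kubo_mori_covariance X U V)"
  unfolding kubo_mori_covariance_def
  by (intro linearI)
    (simp_all add: matrix_add_mult_distrib trace_add matrix_mult_scaleR_left linear_cmul[OF linear_trace]
      add_divide_distrib algebra_simps)

lemma linear_kubo_mori_covariance_right:
  assumes "symmetric_matrix X"
  shows "linear (kubo_mori_covariance X U)"
proof -
  have "kubo_mori_covariance X U = (\<lambda>V. kubo_mori_covariance X V U)"
    using kubo_mori_covariance_commute[OF assms] by blast
  then show ?thesis by (simp only: linear_kubo_mori_covariance_left)
qed

lemma trace_square_symmetric:
  fixes X :: "real^'n^'n"
  assumes "symmetric_matrix X"
  shows "trace (X ** X) = (norm X)\<^sup>2"
proof -
  have "X $ j $ i = X $ i $ j" for i j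
    using assms unfolding symmetric_matrix_def transpose_def vec_eq_iff by simp
  then show ?thesis
    by (simp add: trace_mult power2_norm_eq_inner inner_vec_def)
qed

lemma norm_conjugate_symmetric:
  assumes "orthogonal_matrix P" "symmetric_matrix X"
  shows "norm (conjugate P X) = norm X"
proof -
  have "(norm (conjugate P X))\<^sup>2 = trace (conjugate P (X ** X))"
    by (simp add: conjugate_mult assms trace_square_symmetric[symmetric] symmetric_conjugate)
  also have "\<dots> = (norm X)\<^sup>2"
    by (simp add: trace_conjugate assms trace_square_symmetric)
  finally show ?thesis by simp
qed

lemma norm_square_matrix: "(norm (X :: real^'n^'m))\<^sup>2 = (\<Sum>i\<in>UNIV. \<Sum>j\<in>UNIV. (X $ i $ j)\<^sup>2)"
  unfolding power2_norm_eq_inner by (simp add: inner_vec_def power2_eq_square)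

lemma finite_type_maximum:
  fixes d :: "'n::finite \<Rightarrow> real"
  obtains q where "\<And>i. d i \<le> d q"
proof -
  have "Max (range d) \<in> range d" by (rule Max_in) auto
  then obtain q where "d q = Max (range d)" by (metis rangeE)
  then show thesis using Max_ge[of "range d"] by (intro that[of q]) auto
qed

text \<open>In the eigenbasis the covariance is \<open>S / Z - T\<^sup>2 / Z\<^sup>2\<close>, where \<open>S\<close> weights the squared entries of \<open>V\<close>
  by slopes of \<open>exp\<close> that are all at least \<open>exp m\<close>. Off the diagonal this suffices. On the
  diagonal the surplus weights \<open>w i = exp (d i) - exp m \<ge> 0\<close> have to pay for \<open>T\<^sup>2 / Z\<close>: since
  \<open>V\<close> is traceless, \<open>T\<close> does not change when \<open>exp (d i)\<close> is replaced by \<open>w i\<close>, and the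
  Cauchy-Schwarz inequality with the weights \<open>w\<close> applies.\<close>

lemma kubo_mori_covariance_ge_min_eigenvalue:
  assumes D: "diagonalized P X d" and V: "symmetric_matrix V" "trace V = 0"
    and m: "\<And>i. m \<le> d i"
  shows "exp m / trace (matrix_exp X) * (norm V)\<^sup>2 \<le> kubo_mori_covariance X V V"
proof -
  interpret diagonalized P X d by fact
  define W where "W = conjugate P V"
  define Z where "Z = (\<Sum>i\<in>UNIV. exp (d i))"
  define w where "w i = exp (d i) - exp m" for i
  define S where "S = (\<Sum>i\<in>UNIV. \<Sum>j\<in>UNIV. (W $ i $ j)\<^sup>2 * exp_slope (d i) (d j))"
  define T where "T = (\<Sum>i\<in>UNIV. W $ i $ i * exp (d i))"
  have Z: "Z > 0" by (simp add: Z_def sum_pos)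
  have w: "0 \<le> w i" for i using m[of i] by (simp add: w_def)
  have sym: "W $ j $ i = W $ i $ j" for i j
    using symmetric_conjugate[OF V(1), of P]
    unfolding W_def symmetric_matrix_def transpose_def vec_eq_iff by simp
  have cov: "kubo_mori_covariance X V V = S / Z - T\<^sup>2 / Z\<^sup>2"
    by (simp add: kubo_mori_covariance_def matrix_exp_eq trace_exp trace_mult_exp
        trace_mult_exp_direction W_def[symmetric] sym S_def T_def Z_def power2_eq_square)
  have trW: "(\<Sum>i\<in>UNIV. W $ i $ i) = 0"
    using trace_conjugate[OF P, of V] V by (simp add: W_def trace_def)
  have T_eq: "T = (\<Sum>i\<in>UNIV. w i * W $ i $ i)"
    using trW by (simp add: T_def w_def algebra_simps sum_subtractf sum_distrib_left[symmetric])
  have "T\<^sup>2 = (\<Sum>i\<in>UNIV. sqrt (w i) * (sqrt (w i) * W $ i $ i))\<^sup>2"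
    unfolding T_eq mult.assoc[symmetric] using w by simp
  also have "\<dots> \<le> (\<Sum>i\<in>UNIV. (sqrt (w i))\<^sup>2) * (\<Sum>i\<in>UNIV. (sqrt (w i) * W $ i $ i)\<^sup>2)"
    by (rule Cauchy_Schwarz_ineq_sum)
  also have "\<dots> = (\<Sum>i\<in>UNIV. w i) * (\<Sum>i\<in>UNIV. w i * (W $ i $ i)\<^sup>2)"
    using w by (simp add: power_mult_distrib)
  also have "\<dots> \<le> Z * (\<Sum>i\<in>UNIV. w i * (W $ i $ i)\<^sup>2)"
    unfolding Z_def using w by (intro mult_right_mono sum_mono sum_nonneg) (auto simp: w_def)
  finally have T: "T\<^sup>2 / Z \<le> (\<Sum>i\<in>UNIV. w i * (W $ i $ i)\<^sup>2)"
    using Z by (simp add: field_simps)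
  have "exp m * (norm V)\<^sup>2 + (\<Sum>i\<in>UNIV. w i * (W $ i $ i)\<^sup>2)
      = (\<Sum>i\<in>UNIV. \<Sum>j\<in>UNIV. (exp m + (if i = j then w i else 0)) * (W $ i $ j)\<^sup>2)"
  proof -
    have "(\<Sum>j\<in>UNIV. (exp m + (if i = j then w i else 0)) * (W $ i $ j)\<^sup>2)
        = (\<Sum>j\<in>UNIV. exp m * (W $ i $ j)\<^sup>2 + (if i = j then w i * (W $ i $ i)\<^sup>2 else 0))" for i
      by (rule sum.cong) (auto simp: algebra_simps)
    moreover have "(norm V)\<^sup>2 = (\<Sum>i\<in>UNIV. \<Sum>j\<in>UNIV. (W $ i $ j)\<^sup>2)"
      using norm_conjugate_symmetric[OF P V(1)] by (simp add: W_def norm_square_matrix[symmetric])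
    ultimately show ?thesis by (simp add: sum.distrib sum_distrib_left)
  qed
  also have "\<dots> \<le> S"
    unfolding S_def
  proof (intro sum_mono)
    fix i j
    have "exp m + (if i = j then w i else 0) \<le> exp_slope (d i) (d j)"
      using exp_le_exp_slope[OF m m] by (auto simp: w_def)
    then show "(exp m + (if i = j then w i else 0)) * (W $ i $ j)\<^sup>2
        \<le> (W $ i $ j)\<^sup>2 * exp_slope (d i) (d j)"
      by (subst mult.commute) (intro mult_left_mono, auto)
  qed
  finally have "exp m * (norm V)\<^sup>2 \<le> S - T\<^sup>2 / Z" using T by simp
  then have "exp m * (norm V)\<^sup>2 / Z \<le> (S - T\<^sup>2 / Z) / Z"
    using Z by (intro divide_right_mono) auto
  then show ?thesis
    by (simp add: cov trace_exp matrix_exp_eq Z_def[symmetric] diff_divide_distrib power2_eq_square)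
qed

text \<open>The least eigenvalue of the Gibbs state is at least \<open>exp (\<lambda>\<^sub>m\<^sub>i\<^sub>n - \<lambda>\<^sub>m\<^sub>a\<^sub>x) / n\<close>. The spread of the spectrum
  involves only two eigenvalues, so it is at most \<open>sqrt 2\<close> times the Frobenius norm.\<close>

lemma kubo_mori_covariance_ge:
  fixes X V :: "real^'n^'n"
  assumes X: "symmetric_matrix X" and V: "symmetric_matrix V" "trace V = 0"
  shows "exp (- (sqrt 2 * norm X)) / real CARD('n) * (norm V)\<^sup>2 \<le> kubo_mori_covariance X V V"
proof -
  obtain P d where D: "diagonalized P X d"
    using symmetric_matrix_diagonalizable[OF X] unfolding diagonalized_def by metis
  interpret diagonalized P X d by fact
  obtain p where p: "\<And>i. d p \<le> d i"
    using finite_type_maximum[of "\<lambda>i. - d i"] by (metis neg_le_iff_le)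
  obtain q where q: "\<And>i. d i \<le> d q"
    using finite_type_maximum[of d] by metis
  have "(norm X)\<^sup>2 = (\<Sum>i\<in>UNIV. (d i)\<^sup>2)"
    using trace_square_symmetric[OF X] trace_mult_diagonalized[of X]
    by (simp add: diag diag_matrix_def power2_eq_square)
  moreover have "(\<Sum>i\<in>{p, q}. (d i)\<^sup>2) \<le> (\<Sum>i\<in>UNIV. (d i)\<^sup>2)"
    by (intro sum_mono2) auto
  moreover have "(d q - d p)\<^sup>2 \<le> 2 * (\<Sum>i\<in>{p, q}. (d i)\<^sup>2)"
  proof (cases "p = q")
    case False
    have "0 \<le> (d q + d p)\<^sup>2" by simp
    then show ?thesis using False by (simp add: power2_eq_square algebra_simps)
  qed simp
  ultimately have "(d q - d p)\<^sup>2 \<le> (sqrt 2 * norm X)\<^sup>2"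
    by (simp add: power_mult_distrib)
  then have spread: "d q - d p \<le> sqrt 2 * norm X"
    by (rule power2_le_imp_le) simp
  have "trace (matrix_exp X) \<le> (\<Sum>i\<in>(UNIV :: 'n set). exp (d q))"
    unfolding matrix_exp_eq trace_exp using q by (intro sum_mono) simp
  then have "exp (d p) / (real CARD('n) * exp (d q)) \<le> exp (d p) / trace (matrix_exp X)"
    using trace_matrix_exp_pos[OF X] by (intro divide_left_mono) auto
  moreover have "exp (- (sqrt 2 * norm X)) \<le> exp (d p - d q)"
    using spread by simp
  then have "exp (- (sqrt 2 * norm X)) / real CARD('n) \<le> exp (d p) / (real CARD('n) * exp (d q))"
    by (simp add: exp_diff field_simps)
  ultimately have "exp (- (sqrt 2 * norm X)) / real CARD('n) * (norm V)\<^sup>2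
      \<le> exp (d p) / trace (matrix_exp X) * (norm V)\<^sup>2"
    by (intro mult_right_mono) auto
  also have "\<dots> \<le> kubo_mori_covariance X V V"
    using D V p by (rule kubo_mori_covariance_ge_min_eigenvalue)
  finally show ?thesis .
qed

section \<open>Linear functionals on the spectraplex\<close>

text \<open>In an eigenbasis of \<open>M\<close> the left-hand side is a convex combination of eigenvalues of \<open>M\<close>, hence
  at most the largest one, whose exponential is one of the summands of \<open>tr (exp M)\<close>.\<close>

lemma trace_mult_spectraplex_le:
  fixes M X :: "real^'n^'n"
  assumes M: "symmetric_matrix M" and X: "X \<in> spectraplex"
  shows "trace (M ** X) \<le> ln (trace (matrix_exp M))"
proof -
  obtain P d where D: "diagonalized P M d"
    using symmetric_matrix_diagonalizable[OF M] unfolding diagonalized_def by metis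
  interpret diagonalized P M d by fact
  obtain q where q: "\<And>i. d i \<le> d q"
    using finite_type_maximum[of d] by metis
  have nonneg: "0 \<le> conjugate P X $ i $ i" for i
  proof -
    have "conjugate P X $ i $ i = P $ i \<bullet> (X *v P $ i)"
      by (subst conjugate_def, subst matrix_mul_assoc[symmetric])
        (simp add: matrix_matrix_mult_def matrix_vector_mult_def inner_vec_def transpose_def)
    then show ?thesis using X by (simp add: spectraplex_def psd_def)
  qed
  have "trace (M ** X) = (\<Sum>i\<in>UNIV. d i * conjugate P X $ i $ i)"
    by (rule trace_mult_diagonalized)
  also have "\<dots> \<le> (\<Sum>i\<in>UNIV. d q * conjugate P X $ i $ i)"
    using q nonneg by (intro sum_mono mult_right_mono)
  also have "\<dots> = d q * trace (conjugate P X)"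
    by (simp add: trace_def sum_distrib_left)
  also have "\<dots> = d q"
    using X by (simp add: trace_conjugate[OF P] spectraplex_def)
  also have "d q = ln (exp (d q))" by simp
  also have "\<dots> \<le> ln (trace (matrix_exp M))"
  proof -
    have "exp (d q) \<le> (\<Sum>i\<in>UNIV. exp (d i))"
      by (rule member_le_sum) auto
    then show ?thesis
      using trace_matrix_exp_pos[OF M] by (subst ln_le_cancel_iff) (auto simp: matrix_exp_eq trace_exp)
  qed
  finally show ?thesis .
qed

section \<open>Matrix pencils\<close>

lemma linear_pencil: "linear (pencil A)"
  by (intro linearI)
    (simp_all add: pencil_def scaleR_add_left sum.distrib scaleR_sum_right)

lemma pencil_axis: "pencil A (axis i 1) = A i"
proof -
  have "pencil A (axis i 1) = (\<Sum>j\<in>UNIV. if j = i then A j else 0)"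
    unfolding pencil_def axis_def by (rule sum.cong) auto
  then show ?thesis by simp
qed

lemma symmetric_pencil:
  assumes "\<forall>i. symmetric_matrix (A i)"
  shows "symmetric_matrix (pencil A y)"
  using assms
  by (simp add: symmetric_matrix_def pencil_def transpose_def vec_eq_iff)

lemma trace_pencil: "trace (pencil A y) = (\<Sum>i\<in>UNIV. y $ i * trace (A i))"
  by (simp add: pencil_def linear_sum[OF linear_trace] linear_cmul[OF linear_trace])

lemma trace_pencil_mult: "trace (pencil A y ** X) = trace_map A X \<bullet> y"
proof -
  have "linear (\<lambda>M. trace (M ** X))"
    using bounded_linear_compose[OF bounded_linear_trace
        bounded_bilinear.bounded_linear_left[OF bounded_bilinear_matrix_mult, of X]]
    by (simp add: linear_linear)
  then show ?thesis
    by (simp add: pencil_def linear_sum[of "\<lambda>M. trace (M ** X)"] linear_cmul[of "\<lambda>M. trace (M ** X)"]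
        trace_map_def inner_vec_def mult.commute)
qed

lemma norm_pencil:
  assumes "\<forall>i. symmetric_matrix (A i)"
    and "\<forall>i j. trace (A i ** A j) = (if i = j then 1 else 0)"
  shows "norm (pencil A y) = norm y"
proof -
  have "trace_map A (pencil A y) $ i = y $ i" for i
  proof -
    have "trace (pencil A y ** A i) = (\<Sum>j\<in>UNIV. trace (A j ** A i) * y $ j)"
      by (simp add: trace_pencil_mult trace_map_def inner_vec_def)
    also have "\<dots> = (\<Sum>j\<in>UNIV. if j = i then y $ j else 0)"
      using assms(2) by (intro sum.cong) auto
    finally show ?thesis using trace_mul_sym[of "A i" "pencil A y"] by (simp add: trace_map_def)
  qed
  then have "trace_map A (pencil A y) = y"
    by (simp add: vec_eq_iff)
  then have "trace (pencil A y ** pencil A y) = y \<bullet> y"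
    by (simp add: trace_pencil_mult)
  then have "(norm (pencil A y))\<^sup>2 = (norm y)\<^sup>2"
    by (simp add: trace_square_symmetric symmetric_pencil assms(1) power2_norm_eq_inner)
  then show ?thesis by simp
qed

lemma linear_functional_expansion:
  fixes g :: "real^'m \<Rightarrow> real"
  assumes "linear g"
  shows "(\<Sum>i\<in>UNIV. v $ i * g (axis i 1)) = g v"
proof -
  have "g v = g (\<Sum>i\<in>UNIV. v $ i *\<^sub>R axis i 1)"
    using basis_expansion[of v] by (simp add: scalar_mult_eq_scaleR)
  then show ?thesis by (simp add: linear_sum[OF assms] linear_cmul[OF assms])
qed

section \<open>The log-trace-exponential potential\<close>

text \<open>A ball is connected, so it cannot leave \<open>S\<close> without meeting the frontier.\<close>

lemma ball_infdist_frontier_subset: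
  fixes c :: "'a::euclidean_space"
  assumes "c \<in> S"
  shows "ball c (infdist c (frontier S)) \<subseteq> S"
proof (rule ccontr)
  let ?B = "ball c (infdist c (frontier S))"
  assume "\<not> ?B \<subseteq> S"
  then obtain x where x: "x \<in> ?B" "x \<notin> S" by blast
  then have "c \<in> ?B" using le_less_trans[OF zero_le_dist[of c x]] by auto
  then have "?B \<inter> S \<noteq> {}" "?B - S \<noteq> {}"
    using assms x by blast+
  then have "?B \<inter> frontier S \<noteq> {}"
    by (intro connected_Int_frontier) auto
  then obtain z where "z \<in> ?B" "z \<in> frontier S" by blast
  then show False using infdist_le[of z "frontier S" c] by simp
qed

context
  fixes A :: "'m::finite \<Rightarrow> real^'n^'n" and b :: "real^'m"
  assumes sym: "\<forall>i. symmetric_matrix (A i)"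
begin

lemma has_derivative_trace_exp_pencil:
  "((\<lambda>y. trace (W ** exp_derivative Vs (pencil A y))) has_derivative
    (\<lambda>v. trace (W ** exp_derivative (pencil A v # Vs) (pencil A y)))) (at y)"
  using linear_imp_has_derivative[OF linear_pencil] has_derivative_trace_exp_derivative
  by (rule has_derivative_compose)

lemma trace_exp_direction_pencil:
  "trace (exp_derivative [U] (pencil A y)) = trace (U ** matrix_exp (pencil A y))"
proof -
  obtain P d where "diagonalized P (pencil A y) d"
    using symmetric_matrix_diagonalizable[OF symmetric_pencil[OF sym]] unfolding diagonalized_def by metis
  then show ?thesis by (simp add: diagonalized.trace_exp_direction matrix_exp_eq)
qed

lemma trace_matrix_exp_pencil_pos: "trace (matrix_exp (pencil A y)) > 0"
  by (rule trace_matrix_exp_pos[OF symmetric_pencil[OF sym]])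

lemma has_derivative_trace_matrix_exp_pencil:
  "((\<lambda>y. trace (matrix_exp (pencil A y))) has_derivative
    (\<lambda>v. trace (pencil A v ** matrix_exp (pencil A y)))) (at y)"
  using has_derivative_trace_exp_pencil[of "mat 1" "[]" y]
  by (simp add: trace_exp_direction_pencil matrix_exp_eq[symmetric])

lemma has_derivative_log_tr_exp:
  "(log_tr_exp A b has_derivative
    (\<lambda>u. trace (pencil A u ** matrix_exp (pencil A y)) / trace (matrix_exp (pencil A y)) - b \<bullet> u)) (at y)"
  unfolding log_tr_exp_def[abs_def] divide_inverse
  by (intro has_derivative_diff has_derivative_ln trace_matrix_exp_pencil_pos
      has_derivative_trace_matrix_exp_pencil has_derivative_inner_right has_derivative_ident)

lemma has_derivative_gradient_log_tr_exp:
  "((\<lambda>y. trace (pencil A u ** matrix_exp (pencil A y)) / trace (matrix_exp (pencil A y)) - b \<bullet> u)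
    has_derivative (\<lambda>v. kubo_mori_covariance (pencil A y) (pencil A u) (pencil A v))) (at y)"
proof -
  let ?Z = "trace (matrix_exp (pencil A y))"
  have Z: "?Z \<noteq> 0" using trace_matrix_exp_pencil_pos[of y] by simp
  have "((\<lambda>y. trace (pencil A u ** matrix_exp (pencil A y)) / trace (matrix_exp (pencil A y)) - b \<bullet> u)
    has_derivative (\<lambda>v. (trace (pencil A u ** exp_derivative [pencil A v] (pencil A y)) * ?Z
        - trace (pencil A u ** matrix_exp (pencil A y)) * trace (pencil A v ** matrix_exp (pencil A y)))
      / (?Z * ?Z) - 0)) (at y)"
    using has_derivative_trace_exp_pencil[of "pencil A u" "[]" y, folded matrix_exp_eq]
    by (intro has_derivative_diff has_derivative_divide' has_derivative_trace_matrix_exp_pencil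
        has_derivative_const Z)
  then show ?thesis
    using Z by (simp add: kubo_mori_covariance_def diff_divide_distrib power2_eq_square)
qed

lemma smooth_log_tr_exp: "smooth (log_tr_exp A b)"
  unfolding smooth_def
proof
  fix k
  have "C_k k (\<lambda>X. trace (matrix_exp (X :: real^'n^'n)))"
    unfolding matrix_exp_eq by (rule C_k_trace_exp_derivative)
  then have "C_k k (\<lambda>y. trace (matrix_exp (pencil A y)))"
    by (rule C_k_linear_compose[OF linear_pencil])
  then have "C_k k (\<lambda>y. ln (trace (matrix_exp (pencil A y))))"
    by (rule C_k_ln) (rule trace_matrix_exp_pencil_pos)
  moreover have "C_k k (\<lambda>y. - (b \<bullet> y))"
    by (intro C_k_bounded_linear bounded_linear_minus bounded_linear_inner_right)
  ultimately have "C_k k (\<lambda>y. ln (trace (matrix_exp (pencil A y))) + - (b \<bullet> y))"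
    by (rule C_k_add)
  then show "C_k k (log_tr_exp A b)"
    by (simp add: log_tr_exp_def[abs_def])
qed

lemma hessian_log_tr_exp:
  "hessian (log_tr_exp A b) y $ i $ j = kubo_mori_covariance (pencil A y) (A j) (A i)"
proof -
  have "frechet_derivative (log_tr_exp A b) (at x)
      = (\<lambda>u. trace (pencil A u ** matrix_exp (pencil A x)) / trace (matrix_exp (pencil A x)) - b \<bullet> u)" for x
    using frechet_derivative_at[OF has_derivative_log_tr_exp] by simp
  then show ?thesis
    unfolding hessian_def vec_lambda_beta
    by (simp only: frechet_derivative_at[OF has_derivative_gradient_log_tr_exp, symmetric])
      (simp only: pencil_axis)
qed

text \<open>The covariance is bilinear and \<open>pencil A\<close> is linear, so the entries of the Hessian determine the
  second derivative in every direction.\<close>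

lemma hessian_log_tr_exp_quadratic:
  "v \<bullet> (hessian (log_tr_exp A b) y *v v) = kubo_mori_covariance (pencil A y) (pencil A v) (pencil A v)"
proof -
  let ?B = "\<lambda>u v. kubo_mori_covariance (pencil A y) (pencil A u) (pencil A v)"
  have lin1: "linear (\<lambda>u. ?B u w)" for w
    using linear_compose[OF linear_pencil linear_kubo_mori_covariance_left] by (simp add: o_def)
  have lin2: "linear (\<lambda>w. ?B u w)" for u
    using linear_compose[OF linear_pencil linear_kubo_mori_covariance_right[OF symmetric_pencil[OF sym]]]
    by (simp add: o_def)
  have "v \<bullet> (hessian (log_tr_exp A b) y *v v)
      = (\<Sum>i\<in>UNIV. v $ i * (\<Sum>j\<in>UNIV. v $ j * ?B (axis j 1) (axis i 1)))"
    by (simp add: inner_vec_def matrix_vector_mult_def hessian_log_tr_exp pencil_axis mult.commute)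
  also have "\<dots> = ?B v v"
    by (simp add: linear_functional_expansion[OF lin1] linear_functional_expansion[OF lin2])
  finally show ?thesis .
qed

lemma symmetric_hessian_log_tr_exp: "symmetric_matrix (hessian (log_tr_exp A b) y)"
  by (simp add: symmetric_matrix_def transpose_def vec_eq_iff hessian_log_tr_exp
      kubo_mori_covariance_commute[OF symmetric_pencil[OF sym]])

text \<open>A point of the moment body is the vector of expectations of the \<open>A i\<close> in some state, so this is
  the bound for linear functionals on the spectraplex applied to \<open>pencil A y\<close>.\<close>

lemma log_tr_exp_ge_moment_body:
  assumes "p \<in> moment_body A"
  shows "(p - b) \<bullet> y \<le> log_tr_exp A b y"
proof -
  obtain X where X: "X \<in> spectraplex" "p = trace_map A X"
    using assms by (auto simp: moment_body_def)
  have "p \<bullet> y \<le> ln (trace (matrix_exp (pencil A y)))"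
    using trace_mult_spectraplex_le[OF symmetric_pencil[OF sym] X(1)]
    by (simp add: trace_pencil_mult X(2))
  then show ?thesis by (simp add: log_tr_exp_def inner_diff_left)
qed

text \<open>The potential at a unit vector bounds the moment body in that direction. Consequently its
  frontier is nonempty, and the distance to the frontier is not the default value \<open>0\<close> of
  \<open>infdist\<close>.\<close>

lemma moment_body_ne_UNIV: "moment_body A \<noteq> UNIV"
proof
  assume univ: "moment_body A = UNIV"
  define e :: "real^'m" where "e = axis undefined 1"
  have "e \<bullet> e = 1" by (simp add: e_def inner_axis_axis)
  moreover have "(b + (log_tr_exp A b e + 1) *\<^sub>R e - b) \<bullet> e \<le> log_tr_exp A b e"
    by (rule log_tr_exp_ge_moment_body) (simp add: univ)
  ultimately show False by simp
qed

lemma infdist_frontier_moment_body_pos: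
  assumes "b \<in> interior (moment_body A)"
  shows "infdist b (frontier (moment_body A)) > 0"
proof -
  have "frontier (moment_body A) \<noteq> {}"
    using assms interior_subset moment_body_ne_UNIV by (intro frontier_not_empty) auto
  moreover have "b \<notin> frontier (moment_body A)"
    using assms by (simp add: frontier_def)
  ultimately have "infdist b (frontier (moment_body A)) \<noteq> 0"
    using in_closed_iff_infdist_zero[OF frontier_closed] by blast
  then show ?thesis using infdist_nonneg[of b "frontier (moment_body A)"] by linarith
qed

text \<open>Apply the bound for points of the moment body at points \<open>b + t y / |y|\<close> with \<open>t\<close> increasing to the
  distance of \<open>b\<close> from the frontier.\<close>

lemma log_tr_exp_coercive:
  assumes b: "b \<in> interior (moment_body A)"
  shows "infdist b (frontier (moment_body A)) * norm y \<le> log_tr_exp A b y"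
proof (cases "y = 0")
  case True
  then show ?thesis
    using log_tr_exp_ge_moment_body[of b 0] b interior_subset by auto
next
  case False
  let ?\<delta> = "infdist b (frontier (moment_body A))"
  have "t \<le> log_tr_exp A b y / norm y" if t: "0 < t" "t < ?\<delta>" for t
  proof -
    have "b + t *\<^sub>R sgn y \<in> ball b ?\<delta>"
      using False t by (simp add: dist_norm norm_sgn)
    then have "b + t *\<^sub>R sgn y \<in> moment_body A"
      using ball_infdist_frontier_subset[of b "moment_body A"] b interior_subset by blast
    from log_tr_exp_ge_moment_body[OF this, of y]
    have "t * (sgn y \<bullet> y) \<le> log_tr_exp A b y" by simp
    moreover have "sgn y \<bullet> y = norm y"
      using False by (simp add: sgn_div_norm power2_norm_eq_inner[symmetric] power2_eq_square)
    ultimately show ?thesis using False by (simp add: field_simps)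
  qed
  then have "?\<delta> \<le> log_tr_exp A b y / norm y"
    using infdist_frontier_moment_body_pos[OF b] by (rule dense_le_bounded[rotated])
  then show ?thesis using False by (simp add: field_simps)
qed

context
  assumes trace0: "\<forall>i. trace (A i) = 0"
    and orthonormal: "\<forall>i j. trace (A i ** A j) = (if i = j then 1 else 0)"
begin

lemma hessian_log_tr_exp_ge:
  "exp (- (sqrt 2 * norm y)) / real CARD('n) * (norm v)\<^sup>2 \<le> v \<bullet> (hessian (log_tr_exp A b) y *v v)"
  unfolding hessian_log_tr_exp_quadratic
  using kubo_mori_covariance_ge[OF symmetric_pencil[OF sym, of y] symmetric_pencil[OF sym, of v]]
  by (simp add: norm_pencil[OF sym orthonormal] trace_pencil trace0)

text \<open>The second derivative along every line is a covariance, which is nonnegative by the lower bound.\<close>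

lemma convex_on_log_tr_exp: "convex_on UNIV (log_tr_exp A b)"
proof (rule convex_onI)
  fix t and x z :: "real^'m"
  assume t: "0 < t" "t < (1 :: real)"
  define v where "v = z - x"
  let ?f' = "\<lambda>y. trace (pencil A v ** matrix_exp (pencil A y)) / trace (matrix_exp (pencil A y)) - b \<bullet> v"
  let ?f'' = "\<lambda>y. kubo_mori_covariance (pencil A y) (pencil A v) (pencil A v)"
  have line: "((\<lambda>s. x + s *\<^sub>R v) has_derivative (\<lambda>h. h *\<^sub>R v)) (at s)" for s
    by (auto intro!: derivative_eq_intros)
  have "((\<lambda>s. log_tr_exp A b (x + s *\<^sub>R v)) has_real_derivative ?f' (x + s *\<^sub>R v)) (at s)" for s
    using has_derivative_compose[OF line has_derivative_log_tr_exp]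
    by (rule has_derivative_imp_has_field_derivative)
      (simp add: linear_cmul[OF linear_pencil] matrix_mult_scaleR_left linear_cmul[OF linear_trace]
        algebra_simps)
  moreover have "((\<lambda>s. ?f' (x + s *\<^sub>R v)) has_real_derivative ?f'' (x + s *\<^sub>R v)) (at s)" for s
    using has_derivative_compose[OF line has_derivative_gradient_log_tr_exp[of v]]
    by (rule has_derivative_imp_has_field_derivative)
      (simp add: linear_cmul[OF linear_pencil]
        linear_cmul[OF linear_kubo_mori_covariance_right[OF symmetric_pencil[OF sym]]])
  moreover have "0 \<le> ?f'' y" for y
  proof -
    have "0 \<le> exp (- (sqrt 2 * norm y)) / real CARD('n) * (norm v)\<^sup>2" by simp
    also have "\<dots> \<le> ?f'' y"
      using hessian_log_tr_exp_ge[of y v] by (simp only: hessian_log_tr_exp_quadratic)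
    finally show ?thesis .
  qed
  ultimately have "convex_on UNIV (\<lambda>s. log_tr_exp A b (x + s *\<^sub>R v))"
    by (intro f''_ge0_imp_convex[where f' = "\<lambda>s. ?f' (x + s *\<^sub>R v)" and f'' = "\<lambda>s. ?f'' (x + s *\<^sub>R v)"]) auto
  from convex_onD[OF this, of t 0 1] t
  show "log_tr_exp A b ((1 - t) *\<^sub>R x + t *\<^sub>R z)
      \<le> (1 - t) * log_tr_exp A b x + t * log_tr_exp A b z"
    by (simp add: v_def algebra_simps)
qed simp

lemma convex_sublevel_log_tr_exp: "convex {y. log_tr_exp A b y \<le> c}"
proof (rule convexI)
  fix x z and u v :: real
  assume x: "x \<in> {y. log_tr_exp A b y \<le> c}" and z: "z \<in> {y. log_tr_exp A b y \<le> c}"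
    and uv: "0 \<le> u" "0 \<le> v" "u + v = 1"
  have "log_tr_exp A b (u *\<^sub>R x + v *\<^sub>R z) \<le> u * log_tr_exp A b x + v * log_tr_exp A b z"
    using convex_on_log_tr_exp uv unfolding convex_on_def by blast
  also have "\<dots> \<le> c"
    using x z uv by (intro convex_bound_le) auto
  finally show "u *\<^sub>R x + v *\<^sub>R z \<in> {y. log_tr_exp A b y \<le> c}" by simp
qed

end
end

section \<open>Strong convexity on the sublevel set\<close>

theorem theorem4:
  fixes A :: "'m::finite \<Rightarrow> real^'n^'n" and b :: "real^'m" and \<delta> \<alpha> :: real
  assumes "\<forall>i. symmetric_matrix (A i)"
    and "\<forall>i. trace (A i) = 0"
    and "\<forall>i j. trace (A i ** A j) = (if i = j then 1 else 0)"
    and "b \<in> interior (moment_body A)"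
    and "\<delta> = infdist b (frontier (moment_body A))"
    and "\<alpha> = 1 / real CARD('n) * exp (- (sqrt 2 * ln (real CARD('n)) / \<delta>))"
  shows "0 < \<delta>
    \<and> \<alpha> = real CARD('n) powr (- (1 + sqrt 2 / \<delta>))
    \<and> strongly_convex_on \<alpha> {y. log_tr_exp A b y \<le> ln (real CARD('n))} (log_tr_exp A b)"
proof (intro conjI)
  have N: "real CARD('n) > 0" by simp
  show \<delta>: "0 < \<delta>"
    unfolding assms(5) using assms(1,4) by (rule infdist_frontier_moment_body_pos)
  have "real CARD('n) powr (- (1 + sqrt 2 / \<delta>))
      = exp (- ln (real CARD('n))) * exp (- (sqrt 2 * ln (real CARD('n)) / \<delta>))"
    by (simp add: powr_def exp_add[symmetric] algebra_simps)
  then show "\<alpha> = real CARD('n) powr (- (1 + sqrt 2 / \<delta>))"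
    unfolding assms(6) by (simp add: exp_minus inverse_eq_divide)
  have "psd (hessian (log_tr_exp A b) y - \<alpha> *\<^sub>R mat 1)"
    if "log_tr_exp A b y \<le> ln (real CARD('n))" for y
  proof -
    have "\<delta> * norm y \<le> ln (real CARD('n))"
      using log_tr_exp_coercive[OF assms(1,4), of y] that by (simp add: assms(5))
    then have "sqrt 2 * norm y \<le> sqrt 2 * ln (real CARD('n)) / \<delta>"
      using \<delta> by (simp add: field_simps)
    then have "\<alpha> \<le> exp (- (sqrt 2 * norm y)) / real CARD('n)"
      unfolding assms(6) by (simp add: divide_right_mono)
    then have "\<alpha> * (norm v)\<^sup>2 \<le> v \<bullet> (hessian (log_tr_exp A b) y *v v)" for v
      by (rule order_trans[OF mult_right_mono hessian_log_tr_exp_ge[OF assms(1-3)]]) simp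
    moreover have "v \<bullet> ((hessian (log_tr_exp A b) y - \<alpha> *\<^sub>R mat 1) *v v)
        = v \<bullet> (hessian (log_tr_exp A b) y *v v) - \<alpha> * (norm v)\<^sup>2" for v
      by (simp add: matrix_vector_mult_diff_rdistrib scaleR_matrix_vector_assoc[symmetric]
          inner_diff_right power2_norm_eq_inner)
    moreover have "symmetric_matrix (hessian (log_tr_exp A b) y - \<alpha> *\<^sub>R mat 1)"
      using symmetric_hessian_log_tr_exp[OF assms(1), of b y]
      by (simp add: symmetric_matrix_def transpose_def vec_eq_iff mat_def)
    ultimately show ?thesis by (simp add: psd_def)
  qed
  then show "strongly_convex_on \<alpha> {y. log_tr_exp A b y \<le> ln (real CARD('n))} (log_tr_exp A b)"
    unfolding strongly_convex_on_def
    using smooth_log_tr_exp[OF assms(1)] convex_sublevel_log_tr_exp[OF assms(1-3)] by blast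
qed

end
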